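(* Let $n\ge 2$, let $FQ_n$ be the free quandle on the set of generators $\{x_1,x_2,\dots,x_n\}$, and let $T_n=\{y_1,y_2,\dots,y_n\}$ be the trivial quandle on $n$ elements. Then the map $\varphi_{2Q}$ given on the generators of the virtual braid group $VB_n$ by $$\varphi_{2Q}(\sigma_i):\begin{cases}x_i\mapsto x_{i+1}*x_i,\\ x_{i+1}\mapsto x_i,\\ y_i\mapsto y_{i+1},\\ y_{i+1}\mapsto y_i,\end{cases}\qquad \varphi_{2Q}(\rho_i):\begin{cases}x_i\mapsto x_{i+1}*^{-1}y_i,\\ x_{i+1}\mapsto x_i*y_{i+1},\\ y_i\mapsto y_{i+1},\\ y_{i+1}\mapsto y_i,\end{cases}\qquad i=1,\dots,n-1,$$ (all generators $x_k,y_k$ not listed are fixed) induces a homomorphism $VB_n\to \mathrm{Aut}(FQ_n*T_n)$, where $FQ_n*T_n$ is the free product of the quandles $FQ_n$ and $T_n$.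
   Context: A quandle is a set $Q$ with a binary operation $*$ such that: (1) $a*a=a$; (2) for each $a$ the map $I_a:b\mapsto b*a$ is a bijection of $Q$; (3) $(a*b)*c=(a*c)*(b*c)$ for all $a,b,c$. Write $a*^{-1}b=I_b^{-1}(a)$. A quandle is trivial if $a*b=a$ for all $a,b$. The free product $Q_1*Q_2$ of quandles is their coproduct in the category of quandles. Products of automorphisms are taken with the right-action convention $fg(x)=g(f(x))$. The virtual braid group $VB_n$ has generators $\sigma_1,\dots,\sigma_{n-1},\rho_1,\dots,\rho_{n-1}$ and relations $\sigma_i\sigma_{i+1}\sigma_i=\sigma_{i+1}\sigma_i\sigma_{i+1}$, $\rho_i\rho_{i+1}\rho_i=\rho_{i+1}\rho_i\rho_{i+1}$, $\rho_{i+1}\sigma_i\rho_{i+1}=\rho_i\sigma_{i+1}\rho_i$ ($1\le i\le n-2$); $\sigma_i\sigma_j=\sigma_j\sigma_i$, $\rho_i\rho_j=\rho_j\rho_i$, $\sigma_i\rho_j=\rho_j\sigma_i$ ($|i-j|\ge 2$); $\rho_i^2=1$ ($1\le i\le n-1$). *)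

theory Defs
  imports "HOL-Algebra.Bij"
begin

section \<open>Quandles\<close>

record 'a quandle = "'a partial_object" +
  qop :: "'a \<Rightarrow> 'a \<Rightarrow> 'a"  (infixl \<open>\<star>\<index>\<close> 70)

definition quandle :: "('a, 'm) quandle_scheme \<Rightarrow> bool" where
  "quandle Q \<longleftrightarrow>
     (\<forall>a\<in>carrier Q. \<forall>b\<in>carrier Q. a \<star>\<^bsub>Q\<^esub> b \<in> carrier Q) \<and>
     (\<forall>a\<in>carrier Q. a \<star>\<^bsub>Q\<^esub> a = a) \<and>
     (\<forall>a\<in>carrier Q. bij_betw (\<lambda>b. b \<star>\<^bsub>Q\<^esub> a) (carrier Q) (carrier Q)) \<and>
     (\<forall>a\<in>carrier Q. \<forall>b\<in>carrier Q. \<forall>c\<in>carrier Q.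
        (a \<star>\<^bsub>Q\<^esub> b) \<star>\<^bsub>Q\<^esub> c = (a \<star>\<^bsub>Q\<^esub> c) \<star>\<^bsub>Q\<^esub> (b \<star>\<^bsub>Q\<^esub> c))"

definition qinv :: "('a, 'm) quandle_scheme \<Rightarrow> 'a \<Rightarrow> 'a \<Rightarrow> 'a"  (infixl \<open>\<star>inv\<index>\<close> 70) where
  "a \<star>inv\<^bsub>Q\<^esub> b = inv_into (carrier Q) (\<lambda>c. c \<star>\<^bsub>Q\<^esub> b) a"

definition qhom :: "('a, 'm) quandle_scheme \<Rightarrow> ('b, 'k) quandle_scheme \<Rightarrow> ('a \<Rightarrow> 'b) set" where
  "qhom P Q = {f \<in> carrier P \<rightarrow> carrier Q.
     \<forall>a\<in>carrier P. \<forall>b\<in>carrier P. f (a \<star>\<^bsub>P\<^esub> b) = f a \<star>\<^bsub>Q\<^esub> f b}"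

text \<open>The group of automorphisms. The product of \<open>f\<close> and \<open>g\<close> is \<open>x \<mapsto> g (f x)\<close>
  (automorphisms act from the right). As in \<^const>\<open>Bij\<close>, automorphisms are extensional
  functions on the carrier.\<close>

definition qaut :: "('a, 'm) quandle_scheme \<Rightarrow> ('a \<Rightarrow> 'a) monoid" where
  "qaut Q = \<lparr>carrier = qhom Q Q \<inter> Bij (carrier Q),
             mult = (\<lambda>f g. compose (carrier Q) g f),
             one = (\<lambda>x\<in>carrier Q. x)\<rparr>"

definition trivial_quandle :: "'a set \<Rightarrow> 'a quandle" where
  "trivial_quandle X = \<lparr>carrier = X, qop = (\<lambda>a b. a)\<rparr>"

lemma quandle_closed: "quandle Q \<Longrightarrow> a \<in> carrier Q \<Longrightarrow> b \<in> carrier Q \<Longrightarrow> a \<star>\<^bsub>Q\<^esub> b \<in> carrier Q"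
  unfolding quandle_def by blast

lemma quandle_idem: "quandle Q \<Longrightarrow> a \<in> carrier Q \<Longrightarrow> a \<star>\<^bsub>Q\<^esub> a = a"
  unfolding quandle_def by blast

lemma quandle_bij: "quandle Q \<Longrightarrow> a \<in> carrier Q \<Longrightarrow> bij_betw (\<lambda>b. b \<star>\<^bsub>Q\<^esub> a) (carrier Q) (carrier Q)"
  unfolding quandle_def by blast

lemma quandle_distrib:
  "quandle Q \<Longrightarrow> a \<in> carrier Q \<Longrightarrow> b \<in> carrier Q \<Longrightarrow> c \<in> carrier Q \<Longrightarrow>
    (a \<star>\<^bsub>Q\<^esub> b) \<star>\<^bsub>Q\<^esub> c = (a \<star>\<^bsub>Q\<^esub> c) \<star>\<^bsub>Q\<^esub> (b \<star>\<^bsub>Q\<^esub> c)"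
  unfolding quandle_def by blast

lemma qinv_closed:
  assumes "quandle Q" "a \<in> carrier Q" "b \<in> carrier Q"
  shows "a \<star>inv\<^bsub>Q\<^esub> b \<in> carrier Q"
  unfolding qinv_def using quandle_bij[OF assms(1,3)] assms(2)
  by (intro inv_into_into) (simp add: bij_betw_def)

lemma qinv_op:
  assumes "quandle Q" "a \<in> carrier Q" "b \<in> carrier Q"
  shows "(a \<star>inv\<^bsub>Q\<^esub> b) \<star>\<^bsub>Q\<^esub> b = a"
  unfolding qinv_def using quandle_bij[OF assms(1,3)] assms(2)
  by (intro f_inv_into_f[where f = "\<lambda>c. c \<star>\<^bsub>Q\<^esub> b"]) (simp add: bij_betw_def)

lemma op_qinv:
  assumes "quandle Q" "a \<in> carrier Q" "b \<in> carrier Q"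
  shows "(a \<star>\<^bsub>Q\<^esub> b) \<star>inv\<^bsub>Q\<^esub> b = a"
  unfolding qinv_def using bij_betw_imp_inj_on[OF quandle_bij[OF assms(1,3)]] assms(2)
  by (rule inv_into_f_f)

lemma qinv_unique:
  assumes "quandle Q" "c \<in> carrier Q" "b \<in> carrier Q" "c \<star>\<^bsub>Q\<^esub> b = a"
  shows "a \<star>inv\<^bsub>Q\<^esub> b = c"
  using op_qinv[OF assms(1-3)] assms(4) by simp

lemma qhomI:
  assumes "\<And>a. a \<in> carrier P \<Longrightarrow> f a \<in> carrier Q"
    and "\<And>a b. a \<in> carrier P \<Longrightarrow> b \<in> carrier P \<Longrightarrow> f (a \<star>\<^bsub>P\<^esub> b) = f a \<star>\<^bsub>Q\<^esub> f b"
  shows "f \<in> qhom P Q"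
  using assms by (auto simp: qhom_def)

lemma qhom_closed: "f \<in> qhom P Q \<Longrightarrow> a \<in> carrier P \<Longrightarrow> f a \<in> carrier Q"
  by (auto simp: qhom_def)

lemma qhom_op: "f \<in> qhom P Q \<Longrightarrow> a \<in> carrier P \<Longrightarrow> b \<in> carrier P \<Longrightarrow> f (a \<star>\<^bsub>P\<^esub> b) = f a \<star>\<^bsub>Q\<^esub> f b"
  by (auto simp: qhom_def)

lemma qhom_qinv:
  assumes "quandle P" "quandle Q" "f \<in> qhom P Q" "a \<in> carrier P" "b \<in> carrier P"
  shows "f (a \<star>inv\<^bsub>P\<^esub> b) = f a \<star>inv\<^bsub>Q\<^esub> f b"
proof -
  have "f (a \<star>inv\<^bsub>P\<^esub> b) \<star>\<^bsub>Q\<^esub> f b = f ((a \<star>inv\<^bsub>P\<^esub> b) \<star>\<^bsub>P\<^esub> b)"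
    using assms by (simp add: qhom_op qinv_closed)
  also have "\<dots> = f a" using assms by (simp add: qinv_op)
  finally show ?thesis
    using assms by (intro qinv_unique[symmetric]) (simp_all add: qhom_closed[OF assms(3)] qinv_closed)
qed

lemma qhom_compose:
  assumes "f \<in> qhom P Q" "g \<in> qhom Q R"
  shows "(\<lambda>a. g (f a)) \<in> qhom P R"
  using assms by (simp add: qhom_def Pi_iff)

lemma qhom_cong:
  assumes "quandle P" "f \<in> qhom P Q" "\<And>a. a \<in> carrier P \<Longrightarrow> g a = f a"
  shows "g \<in> qhom P Q"
  using assms by (simp add: qhom_def Pi_iff quandle_closed)

lemma quandle_trivial_quandle: "quandle (trivial_quandle X)"
  by (auto simp: quandle_def trivial_quandle_def bij_betw_def inj_on_def)

lemma qaut_simps: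
  "carrier (qaut Q) = qhom Q Q \<inter> Bij (carrier Q)"
  "f \<otimes>\<^bsub>qaut Q\<^esub> g = compose (carrier Q) g f"
  "\<one>\<^bsub>qaut Q\<^esub> = (\<lambda>x\<in>carrier Q. x)"
  by (simp_all add: qaut_def)

lemma group_qaut:
  assumes "quandle Q"
  shows "group (qaut Q)"
proof (rule groupI)
  fix f g assume fg: "f \<in> carrier (qaut Q)" "g \<in> carrier (qaut Q)"
  then have "compose (carrier Q) g f \<in> qhom Q Q"
    using qhom_cong[OF assms qhom_compose[of f Q Q g Q]] by (simp add: qaut_simps compose_def)
  then show "f \<otimes>\<^bsub>qaut Q\<^esub> g \<in> carrier (qaut Q)"
    using fg by (simp add: qaut_simps compose_Bij)
next
  have "(\<lambda>x\<in>carrier Q. x) \<in> qhom Q Q"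
    using assms by (simp add: qhom_def quandle_closed)
  then show "\<one>\<^bsub>qaut Q\<^esub> \<in> carrier (qaut Q)"
    by (simp add: qaut_simps id_Bij)
next
  fix f g h
  assume "f \<in> carrier (qaut Q)" "g \<in> carrier (qaut Q)" "h \<in> carrier (qaut Q)"
  then show "f \<otimes>\<^bsub>qaut Q\<^esub> g \<otimes>\<^bsub>qaut Q\<^esub> h = f \<otimes>\<^bsub>qaut Q\<^esub> (g \<otimes>\<^bsub>qaut Q\<^esub> h)"
    by (simp add: qaut_simps compose_assoc[OF Bij_imp_funcset])
next
  fix f assume f: "f \<in> carrier (qaut Q)"
  then have fext: "f \<in> extensional (carrier Q)" and bij: "bij_betw f (carrier Q) (carrier Q)"
    by (auto simp: qaut_simps Bij_def)
  show "\<one>\<^bsub>qaut Q\<^esub> \<otimes>\<^bsub>qaut Q\<^esub> f = f"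
    by (rule ext) (simp add: qaut_simps compose_def extensional_arb[OF fext])
  define g where "g = (\<lambda>x\<in>carrier Q. inv_into (carrier Q) f x)"
  have gB: "g \<in> Bij (carrier Q)"
    using f by (simp add: g_def qaut_simps restrict_inv_into_Bij)
  have fg: "f (g x) = x" if "x \<in> carrier Q" for x
    using that bij by (simp add: g_def bij_betw_def f_inv_into_f)
  have gc: "g x \<in> carrier Q" if "x \<in> carrier Q" for x
    using that Bij_imp_funcset[OF gB] by (rule funcset_mem[rotated])
  have "g \<in> qhom Q Q"
  proof (rule qhomI[OF gc])
    fix a b assume ab: "a \<in> carrier Q" "b \<in> carrier Q"
    have "f (g (a \<star>\<^bsub>Q\<^esub> b)) = f (g a \<star>\<^bsub>Q\<^esub> g b)"
      using f ab assms by (simp add: qaut_simps qhom_op[of f Q Q] gc fg quandle_closed)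
    then show "g (a \<star>\<^bsub>Q\<^esub> b) = g a \<star>\<^bsub>Q\<^esub> g b"
      by (rule inj_onD[OF bij_betw_imp_inj_on[OF bij]]) (simp_all add: ab assms gc quandle_closed)
  qed
  moreover have "g \<otimes>\<^bsub>qaut Q\<^esub> f = \<one>\<^bsub>qaut Q\<^esub>"
    by (rule ext) (simp add: qaut_simps compose_def fg)
  ultimately show "\<exists>g\<in>carrier (qaut Q). g \<otimes>\<^bsub>qaut Q\<^esub> f = \<one>\<^bsub>qaut Q\<^esub>"
    using gB by (intro bexI[of _ g]) (simp_all add: qaut_simps)
qed


section \<open>Quandles given by generators and relations\<close>

text \<open>Terms over the operations \<open>*\<close> and \<open>*\<^sup>-\<^sup>1\<close>, modulo the congruence generated by the quandle
  laws and the given relations.\<close>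

datatype 'g qterm = QGen 'g | QOp "'g qterm" "'g qterm" | QInv "'g qterm" "'g qterm"

inductive qeq :: "'g set \<Rightarrow> ('g qterm \<times> 'g qterm) set \<Rightarrow> 'g qterm \<Rightarrow> 'g qterm \<Rightarrow> bool"
  for S R where
  qeq_refl: "set_qterm s \<subseteq> S \<Longrightarrow> qeq S R s s"
| qeq_sym: "qeq S R s t \<Longrightarrow> qeq S R t s"
| qeq_trans: "qeq S R s t \<Longrightarrow> qeq S R t u \<Longrightarrow> qeq S R s u"
| qeq_op: "qeq S R s s' \<Longrightarrow> qeq S R t t' \<Longrightarrow> qeq S R (QOp s t) (QOp s' t')"
| qeq_inv: "qeq S R s s' \<Longrightarrow> qeq S R t t' \<Longrightarrow> qeq S R (QInv s t) (QInv s' t')"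
| qeq_rel: "(s, t) \<in> R \<Longrightarrow> set_qterm s \<subseteq> S \<Longrightarrow> set_qterm t \<subseteq> S \<Longrightarrow> qeq S R s t"
| qeq_idem: "set_qterm s \<subseteq> S \<Longrightarrow> qeq S R (QOp s s) s"
| qeq_inv_op: "set_qterm s \<subseteq> S \<Longrightarrow> set_qterm t \<subseteq> S \<Longrightarrow> qeq S R (QOp (QInv s t) t) s"
| qeq_op_inv: "set_qterm s \<subseteq> S \<Longrightarrow> set_qterm t \<subseteq> S \<Longrightarrow> qeq S R (QInv (QOp s t) t) s"
| qeq_distrib: "set_qterm s \<subseteq> S \<Longrightarrow> set_qterm t \<subseteq> S \<Longrightarrow> set_qterm u \<subseteq> S \<Longrightarrow>
    qeq S R (QOp (QOp s t) u) (QOp (QOp s u) (QOp t u))"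

definition qcls :: "'g set \<Rightarrow> ('g qterm \<times> 'g qterm) set \<Rightarrow> 'g qterm \<Rightarrow> 'g qterm set" where
  "qcls S R t = {s. qeq S R t s}"

definition qpres :: "'g set \<Rightarrow> ('g qterm \<times> 'g qterm) set \<Rightarrow> 'g qterm set quandle" where
  "qpres S R = \<lparr>carrier = qcls S R ` {t. set_qterm t \<subseteq> S},
                qop = (\<lambda>A B. {u. \<exists>s\<in>A. \<exists>t\<in>B. qeq S R (QOp s t) u})\<rparr>"

definition free_quandle :: "'g set \<Rightarrow> 'g qterm set quandle" where
  "free_quandle S = qpres S {}"

definition free_quandle_gen :: "'g set \<Rightarrow> 'g \<Rightarrow> 'g qterm set" where
  "free_quandle_gen S g = qcls S {} (QGen g)"

text \<open>The free product: generated by the disjoint union of the carriers, subject to the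
  multiplication tables of both factors. Its universal property as the coproduct, with the
  injections \<open>free_prod_inl\<close> and \<open>free_prod_inr\<close>, is theorem \<open>free_prod_coproduct\<close> below.\<close>

definition free_prod_rels ::
  "('a, 'm) quandle_scheme \<Rightarrow> ('b, 'k) quandle_scheme \<Rightarrow> (('a + 'b) qterm \<times> ('a + 'b) qterm) set" where
  "free_prod_rels P Q =
     {(QOp (QGen (Inl a)) (QGen (Inl b)), QGen (Inl (a \<star>\<^bsub>P\<^esub> b))) | a b. a \<in> carrier P \<and> b \<in> carrier P} \<union>
     {(QOp (QGen (Inr a)) (QGen (Inr b)), QGen (Inr (a \<star>\<^bsub>Q\<^esub> b))) | a b. a \<in> carrier Q \<and> b \<in> carrier Q}"

definition free_prod ::
  "('a, 'm) quandle_scheme \<Rightarrow> ('b, 'k) quandle_scheme \<Rightarrow> ('a + 'b) qterm set quandle" where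
  "free_prod P Q = qpres (carrier P <+> carrier Q) (free_prod_rels P Q)"

definition free_prod_inl ::
  "('a, 'm) quandle_scheme \<Rightarrow> ('b, 'k) quandle_scheme \<Rightarrow> 'a \<Rightarrow> ('a + 'b) qterm set" where
  "free_prod_inl P Q a = qcls (carrier P <+> carrier Q) (free_prod_rels P Q) (QGen (Inl a))"

definition free_prod_inr ::
  "('a, 'm) quandle_scheme \<Rightarrow> ('b, 'k) quandle_scheme \<Rightarrow> 'b \<Rightarrow> ('a + 'b) qterm set" where
  "free_prod_inr P Q b = qcls (carrier P <+> carrier Q) (free_prod_rels P Q) (QGen (Inr b))"

lemma qeq_terms: "qeq S R s t \<Longrightarrow> set_qterm s \<subseteq> S \<and> set_qterm t \<subseteq> S"
  by (induction rule: qeq.induct) auto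

lemma qcls_eq_iff:
  assumes "set_qterm s \<subseteq> S"
  shows "qcls S R s = qcls S R t \<longleftrightarrow> qeq S R s t"
proof
  assume "qcls S R s = qcls S R t"
  moreover have "s \<in> qcls S R s" using assms by (simp add: qcls_def qeq_refl)
  ultimately have "s \<in> qcls S R t" by simp
  then show "qeq S R s t" by (simp add: qcls_def qeq_sym)
next
  assume "qeq S R s t"
  from qeq_trans[OF this] qeq_trans[OF qeq_sym[OF this]]
  show "qcls S R s = qcls S R t"
    unfolding qcls_def by blast
qed

lemma qcls_carrier: "set_qterm t \<subseteq> S \<Longrightarrow> qcls S R t \<in> carrier (qpres S R)"
  by (simp add: qpres_def)

lemma qpres_carrierE:
  assumes "A \<in> carrier (qpres S R)"
  obtains t where "set_qterm t \<subseteq> S" "A = qcls S R t"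
  using assms by (auto simp: qpres_def)

lemma qpres_op:
  assumes "set_qterm s \<subseteq> S" "set_qterm t \<subseteq> S"
  shows "qcls S R s \<star>\<^bsub>qpres S R\<^esub> qcls S R t = qcls S R (QOp s t)"
proof -
  have "(\<exists>s'. qeq S R s s' \<and> (\<exists>t'. qeq S R t t' \<and> qeq S R (QOp s' t') u)) \<longleftrightarrow> qeq S R (QOp s t) u" for u
    using qeq_trans[OF qeq_op] qeq_refl[OF assms(1)] qeq_refl[OF assms(2)] by blast
  then show ?thesis by (simp add: qpres_def qcls_def)
qed

lemma quandle_qpres: "quandle (qpres S R)"
  unfolding quandle_def
proof (intro conjI ballI)
  fix A B assume "A \<in> carrier (qpres S R)" "B \<in> carrier (qpres S R)"
  then show "A \<star>\<^bsub>qpres S R\<^esub> B \<in> carrier (qpres S R)"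
    by (elim qpres_carrierE) (simp add: qpres_op qcls_carrier)
next
  fix A assume A: "A \<in> carrier (qpres S R)"
  then show "A \<star>\<^bsub>qpres S R\<^esub> A = A"
    by (elim qpres_carrierE) (simp add: qpres_op qcls_eq_iff qeq_idem)
  obtain t where t: "set_qterm t \<subseteq> S" "A = qcls S R t"
    using A by (rule qpres_carrierE)
  show "bij_betw (\<lambda>B. B \<star>\<^bsub>qpres S R\<^esub> A) (carrier (qpres S R)) (carrier (qpres S R))"
    unfolding bij_betw_def
  proof
    show "inj_on (\<lambda>B. B \<star>\<^bsub>qpres S R\<^esub> A) (carrier (qpres S R))"
    proof (rule inj_onI)
      fix B C assume "B \<in> carrier (qpres S R)" "C \<in> carrier (qpres S R)"
        and eq: "B \<star>\<^bsub>qpres S R\<^esub> A = C \<star>\<^bsub>qpres S R\<^esub> A"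
      then obtain b c where b: "set_qterm b \<subseteq> S" "B = qcls S R b"
        and c: "set_qterm c \<subseteq> S" "C = qcls S R c"
        by (meson qpres_carrierE)
      have "qeq S R (QOp b t) (QOp c t)"
        using eq b c t by (simp add: qpres_op qcls_eq_iff)
      then have "qeq S R (QInv (QOp b t) t) (QInv (QOp c t) t)"
        using t by (simp add: qeq_inv qeq_refl)
      then have "qeq S R b c"
        using b c t by (meson qeq_op_inv qeq_sym qeq_trans)
      then show "B = C" using b c by (simp add: qcls_eq_iff)
    qed
    show "(\<lambda>B. B \<star>\<^bsub>qpres S R\<^esub> A) ` carrier (qpres S R) = carrier (qpres S R)"
    proof (intro equalityI subsetI)
      fix B assume "B \<in> (\<lambda>B. B \<star>\<^bsub>qpres S R\<^esub> A) ` carrier (qpres S R)"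
      then show "B \<in> carrier (qpres S R)"
        using t by (auto elim!: qpres_carrierE simp: qpres_op qcls_carrier)
    next
      fix B assume "B \<in> carrier (qpres S R)"
      then obtain b where b: "set_qterm b \<subseteq> S" "B = qcls S R b"
        by (rule qpres_carrierE)
      then have "B = qcls S R (QInv b t) \<star>\<^bsub>qpres S R\<^esub> A"
        using t by (simp add: qpres_op qcls_eq_iff qeq_inv_op qeq_sym)
      moreover have "qcls S R (QInv b t) \<in> carrier (qpres S R)"
        using b t by (simp add: qcls_carrier)
      ultimately show "B \<in> (\<lambda>B. B \<star>\<^bsub>qpres S R\<^esub> A) ` carrier (qpres S R)" by blast
    qed
  qed
next
  fix A B C
  assume "A \<in> carrier (qpres S R)" "B \<in> carrier (qpres S R)" "C \<in> carrier (qpres S R)"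
  then show "A \<star>\<^bsub>qpres S R\<^esub> B \<star>\<^bsub>qpres S R\<^esub> C = A \<star>\<^bsub>qpres S R\<^esub> C \<star>\<^bsub>qpres S R\<^esub> (B \<star>\<^bsub>qpres S R\<^esub> C)"
    by (elim qpres_carrierE) (simp add: qpres_op qcls_eq_iff qeq_distrib)
qed

lemma qpres_qinv:
  assumes "set_qterm s \<subseteq> S" "set_qterm t \<subseteq> S"
  shows "qcls S R s \<star>inv\<^bsub>qpres S R\<^esub> qcls S R t = qcls S R (QInv s t)"
  using assms
  by (intro qinv_unique[OF quandle_qpres]) (simp_all add: qcls_carrier qpres_op qcls_eq_iff qeq_inv_op)

primrec qeval :: "('a, 'm) quandle_scheme \<Rightarrow> ('g \<Rightarrow> 'a) \<Rightarrow> 'g qterm \<Rightarrow> 'a" where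
  "qeval Q f (QGen g) = f g"
| "qeval Q f (QOp s t) = qeval Q f s \<star>\<^bsub>Q\<^esub> qeval Q f t"
| "qeval Q f (QInv s t) = qeval Q f s \<star>inv\<^bsub>Q\<^esub> qeval Q f t"

lemma qeval_closed:
  assumes "quandle Q" "f \<in> S \<rightarrow> carrier Q" "set_qterm t \<subseteq> S"
  shows "qeval Q f t \<in> carrier Q"
  using assms(3) by (induction t) (use assms in \<open>auto simp: quandle_closed qinv_closed\<close>)

lemma qeval_qeq:
  assumes "qeq S R s t" "quandle Q" "f \<in> S \<rightarrow> carrier Q"
    and "\<And>s t. (s, t) \<in> R \<Longrightarrow> set_qterm s \<subseteq> S \<Longrightarrow> set_qterm t \<subseteq> S \<Longrightarrow> qeval Q f s = qeval Q f t"
  shows "qeval Q f s = qeval Q f t"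
  using assms(1)
proof (induction rule: qeq.induct)
  case (qeq_distrib s t u)
  then show ?case
    using assms(2,3) by (simp only: qeval.simps) (intro quandle_distrib qeval_closed)
qed (use assms(2-4) in \<open>simp_all add: quandle_idem qinv_op op_qinv qeval_closed\<close>)

theorem qpres_extend:
  assumes "quandle Q" "f \<in> S \<rightarrow> carrier Q"
    and "\<And>s t. (s, t) \<in> R \<Longrightarrow> set_qterm s \<subseteq> S \<Longrightarrow> set_qterm t \<subseteq> S \<Longrightarrow> qeval Q f s = qeval Q f t"
  shows "\<exists>h\<in>qhom (qpres S R) Q. \<forall>g\<in>S. h (qcls S R (QGen g)) = f g"
proof -
  define h where "h A = qeval Q f (SOME t. t \<in> A)" for A
  have h: "h (qcls S R t) = qeval Q f t" if "set_qterm t \<subseteq> S" for t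
  proof -
    have "t \<in> qcls S R t" using that by (simp add: qcls_def qeq_refl)
    then have "(SOME t'. t' \<in> qcls S R t) \<in> qcls S R t" by (rule someI)
    then have "qeq S R t (SOME t'. t' \<in> qcls S R t)" by (simp add: qcls_def)
    from qeval_qeq[OF this assms] show ?thesis by (simp add: h_def)
  qed
  have "h \<in> qhom (qpres S R) Q"
    by (rule qhomI)
       (auto elim!: qpres_carrierE simp: qpres_op h qeval_closed[OF assms(1,2)])
  moreover have "\<forall>g\<in>S. h (qcls S R (QGen g)) = f g" by (simp add: h)
  ultimately show ?thesis by blast
qed

theorem qpres_hom_unique:
  assumes "quandle Q" "h \<in> qhom (qpres S R) Q" "k \<in> qhom (qpres S R) Q"
    and "\<And>g. g \<in> S \<Longrightarrow> h (qcls S R (QGen g)) = k (qcls S R (QGen g))"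
    and "A \<in> carrier (qpres S R)"
  shows "h A = k A"
proof -
  have "set_qterm t \<subseteq> S \<Longrightarrow> h (qcls S R t) = k (qcls S R t)" for t
  proof (induction t)
    case (QGen g)
    then show ?case by (simp add: assms(4))
  next
    case (QOp s t)
    then show ?case
      by (simp add: qpres_op[symmetric] qhom_op[OF assms(2)] qhom_op[OF assms(3)] qcls_carrier)
  next
    case (QInv s t)
    then show ?case
      by (simp add: qpres_qinv[symmetric] qhom_qinv[OF quandle_qpres assms(1,2)]
          qhom_qinv[OF quandle_qpres assms(1,3)] qcls_carrier)
  qed
  then show ?thesis using assms(5) by (auto elim: qpres_carrierE)
qed

lemma quandle_free_quandle: "quandle (free_quandle S)"
  by (simp add: free_quandle_def quandle_qpres)

lemma free_quandle_gen_closed: "g \<in> S \<Longrightarrow> free_quandle_gen S g \<in> carrier (free_quandle S)"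
  by (simp add: free_quandle_def free_quandle_gen_def qcls_carrier)

theorem free_quandle_extend:
  assumes "quandle Q" "f \<in> S \<rightarrow> carrier Q"
  shows "\<exists>h\<in>qhom (free_quandle S) Q. \<forall>g\<in>S. h (free_quandle_gen S g) = f g"
  unfolding free_quandle_def free_quandle_gen_def
  by (rule qpres_extend[OF assms]) simp

theorem free_quandle_hom_unique:
  assumes "quandle Q" "h \<in> qhom (free_quandle S) Q" "k \<in> qhom (free_quandle S) Q"
    and "\<And>g. g \<in> S \<Longrightarrow> h (free_quandle_gen S g) = k (free_quandle_gen S g)"
    and "A \<in> carrier (free_quandle S)"
  shows "h A = k A"
  using qpres_hom_unique[of Q h S "{}" k A] assms
  by (simp add: free_quandle_def free_quandle_gen_def)

lemma quandle_free_prod: "quandle (free_prod P Q)"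
  by (simp add: free_prod_def quandle_qpres)

lemma free_prod_inl_hom:
  assumes "quandle P"
  shows "free_prod_inl P Q \<in> qhom P (free_prod P Q)"
proof (rule qhomI)
  fix a b assume ab: "a \<in> carrier P" "b \<in> carrier P"
  let ?S = "carrier P <+> carrier Q"
  have S: "Inl a \<in> ?S" "Inl b \<in> ?S" "Inl (a \<star>\<^bsub>P\<^esub> b) \<in> ?S"
    using ab quandle_closed[OF assms ab] by auto
  have "(QOp (QGen (Inl a)) (QGen (Inl b)), QGen (Inl (a \<star>\<^bsub>P\<^esub> b))) \<in> free_prod_rels P Q"
    using ab by (auto simp: free_prod_rels_def)
  then have "qeq ?S (free_prod_rels P Q) (QOp (QGen (Inl a)) (QGen (Inl b))) (QGen (Inl (a \<star>\<^bsub>P\<^esub> b)))"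
    by (rule qeq_rel) (use S in simp_all)
  then show "free_prod_inl P Q (a \<star>\<^bsub>P\<^esub> b) = free_prod_inl P Q a \<star>\<^bsub>free_prod P Q\<^esub> free_prod_inl P Q b"
    using S by (simp add: free_prod_inl_def free_prod_def qpres_op qcls_eq_iff qeq_sym)
qed (simp add: free_prod_inl_def free_prod_def qcls_carrier InlI)

lemma free_prod_inr_hom:
  assumes "quandle Q"
  shows "free_prod_inr P Q \<in> qhom Q (free_prod P Q)"
proof (rule qhomI)
  fix a b assume ab: "a \<in> carrier Q" "b \<in> carrier Q"
  let ?S = "carrier P <+> carrier Q"
  have S: "Inr a \<in> ?S" "Inr b \<in> ?S" "Inr (a \<star>\<^bsub>Q\<^esub> b) \<in> ?S"
    using ab quandle_closed[OF assms ab] by auto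
  have "(QOp (QGen (Inr a)) (QGen (Inr b)), QGen (Inr (a \<star>\<^bsub>Q\<^esub> b))) \<in> free_prod_rels P Q"
    using ab by (auto simp: free_prod_rels_def)
  then have "qeq ?S (free_prod_rels P Q) (QOp (QGen (Inr a)) (QGen (Inr b))) (QGen (Inr (a \<star>\<^bsub>Q\<^esub> b)))"
    by (rule qeq_rel) (use S in simp_all)
  then show "free_prod_inr P Q (a \<star>\<^bsub>Q\<^esub> b) = free_prod_inr P Q a \<star>\<^bsub>free_prod P Q\<^esub> free_prod_inr P Q b"
    using S by (simp add: free_prod_inr_def free_prod_def qpres_op qcls_eq_iff qeq_sym)
qed (simp add: free_prod_inr_def free_prod_def qcls_carrier InrI)

theorem free_prod_hom_unique:
  assumes "quandle Z" "h \<in> qhom (free_prod P Q) Z" "k \<in> qhom (free_prod P Q) Z"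
    and "\<And>a. a \<in> carrier P \<Longrightarrow> h (free_prod_inl P Q a) = k (free_prod_inl P Q a)"
    and "\<And>b. b \<in> carrier Q \<Longrightarrow> h (free_prod_inr P Q b) = k (free_prod_inr P Q b)"
    and "A \<in> carrier (free_prod P Q)"
  shows "h A = k A"
  using qpres_hom_unique[of Z h "carrier P <+> carrier Q" "free_prod_rels P Q" k A] assms
  by (auto simp: free_prod_def free_prod_inl_def free_prod_inr_def)

theorem free_prod_coproduct:
  assumes "quandle P" "quandle Q" "quandle Z" "f \<in> qhom P Z" "g \<in> qhom Q Z"
  shows "\<exists>!h. h \<in> qhom (free_prod P Q) Z \<and> h \<in> extensional (carrier (free_prod P Q)) \<and>
            (\<forall>a\<in>carrier P. h (free_prod_inl P Q a) = f a) \<and>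
            (\<forall>b\<in>carrier Q. h (free_prod_inr P Q b) = g b)"
proof -
  let ?S = "carrier P <+> carrier Q"
  let ?F = "case_sum f g"
  have F: "?F \<in> ?S \<rightarrow> carrier Z"
    using assms by (auto simp: qhom_closed)
  have rels: "qeval Z ?F s = qeval Z ?F t" if "(s, t) \<in> free_prod_rels P Q" for s t
    using that assms by (auto simp: free_prod_rels_def qhom_op)
  obtain h where h: "h \<in> qhom (free_prod P Q) Z"
      "\<forall>x\<in>?S. h (qcls ?S (free_prod_rels P Q) (QGen x)) = ?F x"
    using qpres_extend[OF assms(3) F rels] unfolding free_prod_def by blast
  let ?h = "restrict h (carrier (free_prod P Q))"
  have h': "?h \<in> qhom (free_prod P Q) Z"
    by (rule qhom_cong[OF quandle_free_prod h(1)]) simp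
  show ?thesis
  proof (rule ex1I[of _ ?h])
    show H: "?h \<in> qhom (free_prod P Q) Z \<and> ?h \<in> extensional (carrier (free_prod P Q)) \<and>
            (\<forall>a\<in>carrier P. ?h (free_prod_inl P Q a) = f a) \<and>
            (\<forall>b\<in>carrier Q. ?h (free_prod_inr P Q b) = g b)"
      using h' h(2)
        qhom_closed[OF free_prod_inl_hom[OF assms(1), of Q]]
        qhom_closed[OF free_prod_inr_hom[OF assms(2), of P]]
      by (simp add: free_prod_inl_def free_prod_inr_def InlI InrI)
    fix k assume k: "k \<in> qhom (free_prod P Q) Z \<and> k \<in> extensional (carrier (free_prod P Q)) \<and>
            (\<forall>a\<in>carrier P. k (free_prod_inl P Q a) = f a) \<and>
            (\<forall>b\<in>carrier Q. k (free_prod_inr P Q b) = g b)"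
    have "k A = ?h A" if "A \<in> carrier (free_prod P Q)" for A
      by (rule free_prod_hom_unique[OF assms(3) conjunct1[OF k] h' _ _ that])
         (simp_all only: k H)
    then show "k = ?h"
      using k H by (blast intro: extensionalityI)
  qed
qed


section \<open>Groups given by generators and relations\<close>

text \<open>A letter \<open>(g, True)\<close> stands for the generator \<open>g\<close>, and \<open>(g, False)\<close> for its inverse.\<close>

type_synonym 'g gword = "('g \<times> bool) list"

inductive geq :: "'g set \<Rightarrow> ('g gword \<times> 'g gword) set \<Rightarrow> 'g gword \<Rightarrow> 'g gword \<Rightarrow> bool"
  for S R where
  geq_refl: "fst ` set u \<subseteq> S \<Longrightarrow> geq S R u u"
| geq_sym: "geq S R u v \<Longrightarrow> geq S R v u"
| geq_trans: "geq S R u v \<Longrightarrow> geq S R v w \<Longrightarrow> geq S R u w"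
| geq_append: "geq S R u u' \<Longrightarrow> geq S R v v' \<Longrightarrow> geq S R (u @ v) (u' @ v')"
| geq_rel: "(u, v) \<in> R \<Longrightarrow> fst ` set u \<subseteq> S \<Longrightarrow> fst ` set v \<subseteq> S \<Longrightarrow> geq S R u v"
| geq_cancel: "g \<in> S \<Longrightarrow> geq S R [(g, b), (g, \<not> b)] []"

definition gcls :: "'g set \<Rightarrow> ('g gword \<times> 'g gword) set \<Rightarrow> 'g gword \<Rightarrow> 'g gword set" where
  "gcls S R u = {v. geq S R u v}"

definition gpres :: "'g set \<Rightarrow> ('g gword \<times> 'g gword) set \<Rightarrow> 'g gword set monoid" where
  "gpres S R = \<lparr>carrier = gcls S R ` {u. fst ` set u \<subseteq> S},
                mult = (\<lambda>A B. {w. \<exists>u\<in>A. \<exists>v\<in>B. geq S R (u @ v) w}),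
                one = gcls S R []\<rparr>"

lemma geq_words: "geq S R u v \<Longrightarrow> fst ` set u \<subseteq> S \<and> fst ` set v \<subseteq> S"
  by (induction rule: geq.induct) auto

lemma gcls_eq_iff:
  assumes "fst ` set u \<subseteq> S"
  shows "gcls S R u = gcls S R v \<longleftrightarrow> geq S R u v"
proof
  assume "gcls S R u = gcls S R v"
  moreover have "u \<in> gcls S R u" using assms by (simp add: gcls_def geq_refl)
  ultimately have "u \<in> gcls S R v" by simp
  then show "geq S R u v" by (simp add: gcls_def geq_sym)
next
  assume "geq S R u v"
  from geq_trans[OF this] geq_trans[OF geq_sym[OF this]]
  show "gcls S R u = gcls S R v"
    unfolding gcls_def by blast
qed

lemma gcls_carrier: "fst ` set u \<subseteq> S \<Longrightarrow> gcls S R u \<in> carrier (gpres S R)"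
  by (simp add: gpres_def)

lemma gpres_carrierE:
  assumes "A \<in> carrier (gpres S R)"
  obtains u where "fst ` set u \<subseteq> S" "A = gcls S R u"
  using assms by (auto simp: gpres_def)

lemma gpres_one: "\<one>\<^bsub>gpres S R\<^esub> = gcls S R []"
  by (simp add: gpres_def)

lemma gpres_mult:
  assumes "fst ` set u \<subseteq> S" "fst ` set v \<subseteq> S"
  shows "gcls S R u \<otimes>\<^bsub>gpres S R\<^esub> gcls S R v = gcls S R (u @ v)"
proof -
  have "(\<exists>u'. geq S R u u' \<and> (\<exists>v'. geq S R v v' \<and> geq S R (u' @ v') w)) \<longleftrightarrow> geq S R (u @ v) w" for w
    using geq_trans[OF geq_append] geq_refl[OF assms(1)] geq_refl[OF assms(2)] by blast
  then show ?thesis by (simp add: gpres_def gcls_def)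
qed

lemma geq_inverse:
  "fst ` set u \<subseteq> S \<Longrightarrow> geq S R (rev (map (\<lambda>(g, b). (g, \<not> b)) u) @ u) []"
proof (induction u)
  case Nil
  then show ?case by (simp add: geq_refl)
next
  case (Cons x u)
  obtain g b where x: "x = (g, b)" by fastforce
  let ?i = "rev (map (\<lambda>(g, b). (g, \<not> b)) u)"
  have g: "g \<in> S" and u: "fst ` set u \<subseteq> S" using Cons.prems x by auto
  have i: "fst ` set ?i \<subseteq> S" using u by (auto simp: image_iff split_beta)
  have "geq S R [(g, \<not> b), (g, b)] []" using geq_cancel[OF g, of R "\<not> b"] by simp
  then have "geq S R (?i @ [(g, \<not> b), (g, b)] @ u) (?i @ [] @ u)"
    using i u by (intro geq_append geq_refl)
  then have "geq S R (?i @ [(g, \<not> b), (g, b)] @ u) []"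
    using Cons.IH[OF u] by (auto intro: geq_trans)
  then show ?case by (simp add: x)
qed

lemma group_gpres: "group (gpres S R)"
proof (rule groupI)
  fix A assume "A \<in> carrier (gpres S R)"
  then obtain u where u: "fst ` set u \<subseteq> S" "A = gcls S R u" by (rule gpres_carrierE)
  let ?v = "rev (map (\<lambda>(g, b). (g, \<not> b)) u)"
  have v: "fst ` set ?v \<subseteq> S" using u by (auto simp: image_iff split_beta)
  have "gcls S R ?v \<otimes>\<^bsub>gpres S R\<^esub> A = \<one>\<^bsub>gpres S R\<^esub>"
    using geq_inverse[OF u(1), of R] u v
    unfolding u(2) gpres_mult[OF v u(1)] gpres_one
    by (metis gcls_eq_iff geq_words)
  then show "\<exists>B\<in>carrier (gpres S R). B \<otimes>\<^bsub>gpres S R\<^esub> A = \<one>\<^bsub>gpres S R\<^esub>"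
    using gcls_carrier[OF v] by blast
next
  show "\<one>\<^bsub>gpres S R\<^esub> \<in> carrier (gpres S R)" by (simp add: gpres_one gcls_carrier)
qed (elim gpres_carrierE, simp add: gpres_one gpres_mult image_Un gcls_carrier)+

primrec geval :: "('a, 'm) monoid_scheme \<Rightarrow> ('g \<Rightarrow> 'a) \<Rightarrow> 'g gword \<Rightarrow> 'a" where
  "geval G f [] = \<one>\<^bsub>G\<^esub>"
| "geval G f (x # u) = (if snd x then f (fst x) else inv\<^bsub>G\<^esub> f (fst x)) \<otimes>\<^bsub>G\<^esub> geval G f u"

lemma geval_closed:
  assumes "group G" "f \<in> S \<rightarrow> carrier G" "fst ` set u \<subseteq> S"
  shows "geval G f u \<in> carrier G"
proof -
  interpret group G by fact
  show ?thesis using assms(3) by (induction u) (use assms in \<open>auto simp: Pi_iff\<close>)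
qed

lemma geval_append:
  assumes "group G" "f \<in> S \<rightarrow> carrier G" "fst ` set u \<subseteq> S" "fst ` set v \<subseteq> S"
  shows "geval G f (u @ v) = geval G f u \<otimes>\<^bsub>G\<^esub> geval G f v"
proof -
  interpret group G by fact
  show ?thesis using assms(3)
    by (induction u) (use assms in \<open>auto simp: Pi_iff m_assoc geval_closed[OF assms(1,2)]\<close>)
qed

lemma geval_geq:
  assumes "geq S R u v" "group G" "f \<in> S \<rightarrow> carrier G"
    and "\<And>u v. (u, v) \<in> R \<Longrightarrow> fst ` set u \<subseteq> S \<Longrightarrow> fst ` set v \<subseteq> S \<Longrightarrow> geval G f u = geval G f v"
  shows "geval G f u = geval G f v"
proof -
  interpret group G by fact
  show ?thesis using assms(1)
  proof (induction rule: geq.induct)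
    case (geq_append u u' v v')
    then show ?case using geq_words by (metis geval_append[OF assms(2,3)])
  next
    case (geq_cancel g b)
    then have "f g \<in> carrier G" using assms(3) by auto
    then show ?case by simp
  qed (use assms(4) in auto)
qed

theorem gpres_extend:
  assumes "group G" "f \<in> S \<rightarrow> carrier G"
    and "\<And>u v. (u, v) \<in> R \<Longrightarrow> fst ` set u \<subseteq> S \<Longrightarrow> fst ` set v \<subseteq> S \<Longrightarrow> geval G f u = geval G f v"
  shows "\<exists>h\<in>hom (gpres S R) G. \<forall>g\<in>S. h (gcls S R [(g, True)]) = f g"
proof -
  interpret group G by fact
  define h where "h A = geval G f (SOME u. u \<in> A)" for A
  have h: "h (gcls S R u) = geval G f u" if "fst ` set u \<subseteq> S" for u
  proof -
    have "u \<in> gcls S R u" using that by (simp add: gcls_def geq_refl)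
    then have "(SOME u'. u' \<in> gcls S R u) \<in> gcls S R u" by (rule someI)
    then have "geq S R u (SOME u'. u' \<in> gcls S R u)" by (simp add: gcls_def)
    from geval_geq[OF this assms] show ?thesis by (simp add: h_def)
  qed
  have "h \<in> hom (gpres S R) G"
    by (rule homI; elim gpres_carrierE)
       (simp_all add: gpres_mult h image_Un geval_closed[OF assms(1,2)] geval_append[OF assms(1,2)])
  moreover have "\<forall>g\<in>S. h (gcls S R [(g, True)]) = f g"
    using funcset_mem[OF assms(2)] by (simp add: h)
  ultimately show ?thesis by blast
qed


section \<open>The virtual braid group\<close>

datatype vb_gen = Sigma nat | Rho nat

abbreviation vb_word :: "vb_gen list \<Rightarrow> vb_gen gword" where
  "vb_word gs \<equiv> map (\<lambda>g. (g, True)) gs"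

definition vb_gens :: "nat \<Rightarrow> vb_gen set" where
  "vb_gens n = Sigma ` {1..n - 1} \<union> Rho ` {1..n - 1}"

definition far :: "nat \<Rightarrow> nat \<Rightarrow> nat \<Rightarrow> bool" where
  "far n i j \<longleftrightarrow> i \<in> {1..n - 1} \<and> j \<in> {1..n - 1} \<and> \<bar>int i - int j\<bar> \<ge> 2"

definition vb_rels :: "nat \<Rightarrow> (vb_gen gword \<times> vb_gen gword) set" where
  "vb_rels n =
     {(vb_word [Sigma i, Sigma (i+1), Sigma i], vb_word [Sigma (i+1), Sigma i, Sigma (i+1)]) | i. i \<in> {1..n - 2}} \<union>
     {(vb_word [Rho i, Rho (i+1), Rho i], vb_word [Rho (i+1), Rho i, Rho (i+1)]) | i. i \<in> {1..n - 2}} \<union>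
     {(vb_word [Rho (i+1), Sigma i, Rho (i+1)], vb_word [Rho i, Sigma (i+1), Rho i]) | i. i \<in> {1..n - 2}} \<union>
     {(vb_word [Sigma i, Sigma j], vb_word [Sigma j, Sigma i]) | i j. far n i j} \<union>
     {(vb_word [Rho i, Rho j], vb_word [Rho j, Rho i]) | i j. far n i j} \<union>
     {(vb_word [Sigma i, Rho j], vb_word [Rho j, Sigma i]) | i j. far n i j} \<union>
     {(vb_word [Rho i, Rho i], []) | i. i \<in> {1..n - 1}}"

definition virtual_braid_group :: "nat \<Rightarrow> vb_gen gword set monoid" where
  "virtual_braid_group n = gpres (vb_gens n) (vb_rels n)"

definition vb_sigma :: "nat \<Rightarrow> nat \<Rightarrow> vb_gen gword set" where
  "vb_sigma n i = gcls (vb_gens n) (vb_rels n) [(Sigma i, True)]"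

definition vb_rho :: "nat \<Rightarrow> nat \<Rightarrow> vb_gen gword set" where
  "vb_rho n i = gcls (vb_gens n) (vb_rels n) [(Rho i, True)]"

lemma group_virtual_braid_group: "group (virtual_braid_group n)"
  by (simp add: virtual_braid_group_def group_gpres)


section \<open>The quandle \<open>FQ\<^sub>n * T\<^sub>n\<close>\<close>

definition FQ :: "nat \<Rightarrow> nat qterm set quandle" where
  "FQ n = free_quandle {1..n}"

definition TQ :: "nat \<Rightarrow> nat quandle" where
  "TQ n = trivial_quandle {1..n}"

definition FQT :: "nat \<Rightarrow> (nat qterm set + nat) qterm set quandle" where
  "FQT n = free_prod (FQ n) (TQ n)"

definition xg :: "nat \<Rightarrow> nat \<Rightarrow> (nat qterm set + nat) qterm set" where
  "xg n i = free_prod_inl (FQ n) (TQ n) (free_quandle_gen {1..n} i)"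

definition yg :: "nat \<Rightarrow> nat \<Rightarrow> (nat qterm set + nat) qterm set" where
  "yg n i = free_prod_inr (FQ n) (TQ n) i"

theorem FQT_hom_unique:
  assumes "quandle Z" "h \<in> qhom (FQT n) Z" "k \<in> qhom (FQT n) Z"
    and "\<And>i. i \<in> {1..n} \<Longrightarrow> h (xg n i) = k (xg n i) \<and> h (yg n i) = k (yg n i)"
    and "A \<in> carrier (FQT n)"
  shows "h A = k A"
proof -
  let ?l = "free_prod_inl (FQ n) (TQ n)"
  have l: "?l \<in> qhom (FQ n) (FQT n)"
    by (simp add: FQ_def FQT_def free_prod_inl_hom quandle_free_quandle)
  have "h (?l a) = k (?l a)" if "a \<in> carrier (FQ n)" for a
    using free_quandle_hom_unique[OF assms(1), of "\<lambda>a. h (?l a)" "{1..n}" "\<lambda>a. k (?l a)" a]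
      qhom_compose[OF l assms(2)] qhom_compose[OF l assms(3)] assms(4) that
    by (simp add: FQ_def xg_def)
  moreover have "h (free_prod_inr (FQ n) (TQ n) b) = k (free_prod_inr (FQ n) (TQ n) b)"
    if "b \<in> carrier (TQ n)" for b
    using assms(4) that by (simp add: TQ_def trivial_quandle_def yg_def)
  ultimately show ?thesis
    using free_prod_hom_unique[OF assms(1)] assms(2,3,5) unfolding FQT_def by blast
qed

end

theory Submission
  imports Defs
begin

text \<open>By the universal property of the free product, an endomorphism of \<open>FQ\<^sub>n * T\<^sub>n\<close> is given by
  the images of the \<open>x\<^sub>k\<close> and \<open>y\<^sub>k\<close>, subject only to the images of the \<open>y\<^sub>k\<close> acting trivially on
  each other, and two of them agree once they agree on these generators. So it suffices to compare
  both sides of each relation of \<open>VB\<^sub>n\<close> on generators. The relations involving several \<open>\<rho>\<close>'s hold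
  because \<open>y\<^sub>i * y\<^sub>j = y\<^sub>i\<close> makes the translations by \<open>y\<^sub>i\<close> and \<open>y\<^sub>j\<close> commute. The inverse of
  \<open>\<sigma>\<^sub>i\<close> sends \<open>x\<^sub>i\<close> to \<open>x\<^sub>i\<^sub>+\<^sub>1\<close> and \<open>x\<^sub>i\<^sub>+\<^sub>1\<close> to \<open>x\<^sub>i *\<^sup>-\<^sup>1 x\<^sub>i\<^sub>+\<^sub>1\<close>; \<open>\<rho>\<^sub>i\<close> is an involution.\<close>

section \<open>Quandles\<close>

text \<open>Translation by \<open>c\<close> is an automorphism, so its inverse preserves the
  operation as well.\<close>

lemma qinv_distrib:
  assumes "quandle Q" "a \<in> carrier Q" "b \<in> carrier Q" "c \<in> carrier Q"
  shows "(a \<star>\<^bsub>Q\<^esub> b) \<star>inv\<^bsub>Q\<^esub> c = (a \<star>inv\<^bsub>Q\<^esub> c) \<star>\<^bsub>Q\<^esub> (b \<star>inv\<^bsub>Q\<^esub> c)"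
  using assms by (intro qinv_unique) (simp_all add: quandle_distrib qinv_op quandle_closed qinv_closed)

text \<open>Translation by \<open>c\<close> is an automorphism fixing \<open>b\<close>, so it
  commutes with translation by \<open>b\<close>. The next two lemmas carry this over to inverse
  translations.\<close>

lemma op_commute:
  assumes "quandle Q" "a \<in> carrier Q" "b \<in> carrier Q" "c \<in> carrier Q" "b \<star>\<^bsub>Q\<^esub> c = b"
  shows "(a \<star>\<^bsub>Q\<^esub> b) \<star>\<^bsub>Q\<^esub> c = (a \<star>\<^bsub>Q\<^esub> c) \<star>\<^bsub>Q\<^esub> b"
  using quandle_distrib[OF assms(1-4)] assms(5) by simp

lemma op_qinv_commute:
  assumes "quandle Q" "a \<in> carrier Q" "b \<in> carrier Q" "c \<in> carrier Q" "b \<star>\<^bsub>Q\<^esub> c = b"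
  shows "(a \<star>\<^bsub>Q\<^esub> b) \<star>inv\<^bsub>Q\<^esub> c = (a \<star>inv\<^bsub>Q\<^esub> c) \<star>\<^bsub>Q\<^esub> b"
  using qinv_distrib[OF assms(1-4)] op_qinv[OF assms(1,3,4)] assms(5) by simp

lemma qinv_commute:
  assumes "quandle Q" "a \<in> carrier Q" "b \<in> carrier Q" "c \<in> carrier Q" "b \<star>\<^bsub>Q\<^esub> c = b"
  shows "(a \<star>inv\<^bsub>Q\<^esub> b) \<star>inv\<^bsub>Q\<^esub> c = (a \<star>inv\<^bsub>Q\<^esub> c) \<star>inv\<^bsub>Q\<^esub> b"
  using assms
  by (intro qinv_unique[symmetric])
     (simp_all add: op_qinv_commute[symmetric] qinv_op qinv_closed)

lemma qautI:
  assumes "f \<in> qhom Q Q" "f \<in> extensional (carrier Q)" "g \<in> qhom Q Q"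
    and "\<And>a. a \<in> carrier Q \<Longrightarrow> g (f a) = a" "\<And>a. a \<in> carrier Q \<Longrightarrow> f (g a) = a"
  shows "f \<in> carrier (qaut Q)"
proof -
  have "bij_betw f (carrier Q) (carrier Q)"
    using assms by (intro bij_betw_byWitness[where f' = g]) (auto simp: qhom_closed)
  then show ?thesis using assms by (simp add: qaut_simps Bij_def)
qed

text \<open>The right-action product lets the first letter act first, which is the order of
  \<open>fold\<close>. Words without inverse letters suffice for the relations of the virtual braid
  group.\<close>

lemma qaut_eval_word:
  assumes "quandle Q" "f \<in> S \<rightarrow> carrier (qaut Q)" "set gs \<subseteq> S"
  shows "geval (qaut Q) f (map (\<lambda>g. (g, True)) gs) = (\<lambda>a\<in>carrier Q. fold f gs a)"
  using assms(3)
proof (induction gs)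
  case (Cons g gs)
  then have "f g \<in> carrier Q \<rightarrow> carrier Q"
    using funcset_mem[OF assms(2), of g] by (simp add: qaut_simps Bij_imp_funcset)
  then have "f g a \<in> carrier Q" if "a \<in> carrier Q" for a
    using that by (rule funcset_mem)
  then show ?case
    using Cons by (auto simp: qaut_simps compose_def cong: restrict_cong)
qed (simp add: qaut_simps id_def)


section \<open>Endomorphisms of \<open>FQ\<^sub>n * T\<^sub>n\<close>\<close>

lemma quandle_FQT: "quandle (FQT n)"
  by (simp add: FQT_def quandle_free_prod)

lemma xg_closed: "i \<in> {1..n} \<Longrightarrow> xg n i \<in> carrier (FQT n)"
  unfolding FQT_def xg_def FQ_def
  by (intro qhom_closed[OF free_prod_inl_hom] quandle_free_quandle free_quandle_gen_closed)

lemma TQ_simps: "carrier (TQ n) = {1..n}" "i \<star>\<^bsub>TQ n\<^esub> j = i"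
  by (simp_all add: TQ_def trivial_quandle_def)

lemma quandle_TQ: "quandle (TQ n)"
  by (simp add: TQ_def quandle_trivial_quandle)

lemma yg_hom: "yg n \<in> qhom (TQ n) (FQT n)"
  using free_prod_inr_hom[OF quandle_TQ, of "FQ n" n]
  by (simp add: FQT_def yg_def[abs_def])

lemma yg_closed: "i \<in> {1..n} \<Longrightarrow> yg n i \<in> carrier (FQT n)"
  using qhom_closed[OF yg_hom] by (simp add: TQ_simps)

lemma yg_op: "i \<in> {1..n} \<Longrightarrow> j \<in> {1..n} \<Longrightarrow> yg n i \<star>\<^bsub>FQT n\<^esub> yg n j = yg n i"
  using qhom_op[OF yg_hom, of i n j] by (simp add: TQ_simps)

lemma yg_qinv: "i \<in> {1..n} \<Longrightarrow> j \<in> {1..n} \<Longrightarrow> yg n i \<star>inv\<^bsub>FQT n\<^esub> yg n j = yg n i"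
  by (intro qinv_unique[OF quandle_FQT] yg_closed yg_op)

text \<open>\<open>f\<close> extends freely over the free quandle, the condition on \<open>g\<close>
  makes it a homomorphism from the trivial quandle, and the coproduct property joins the
  two.\<close>

theorem FQT_extend:
  assumes "quandle Z" "f \<in> {1..n} \<rightarrow> carrier Z" "g \<in> {1..n} \<rightarrow> carrier Z"
    and "\<And>i j. i \<in> {1..n} \<Longrightarrow> j \<in> {1..n} \<Longrightarrow> g i \<star>\<^bsub>Z\<^esub> g j = g i"
  shows "\<exists>h. h \<in> qhom (FQT n) Z \<and> h \<in> extensional (carrier (FQT n)) \<and>
    (\<forall>k\<in>{1..n}. h (xg n k) = f k \<and> h (yg n k) = g k)"
proof -
  obtain f' where f': "f' \<in> qhom (FQ n) Z" "\<forall>k\<in>{1..n}. f' (free_quandle_gen {1..n} k) = f k"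
    using free_quandle_extend[OF assms(1,2)] by (auto simp: FQ_def)
  have g: "g \<in> qhom (TQ n) Z"
    using assms(3,4) by (intro qhomI) (auto simp: TQ_simps)
  have "quandle (FQ n)" by (simp add: FQ_def quandle_free_quandle)
  from free_prod_coproduct[OF this quandle_TQ assms(1) f'(1) g]
  show ?thesis
    using f'(2) free_quandle_gen_closed[of _ "{1..n}"]
    unfolding FQT_def[symmetric] xg_def yg_def TQ_simps FQ_def[symmetric] by (metis (no_types, lifting))
qed

lemma FQT_endo_eq_id:
  assumes "h \<in> qhom (FQT n) (FQT n)" "k \<in> qhom (FQT n) (FQT n)"
    and "\<And>i. i \<in> {1..n} \<Longrightarrow> k (h (xg n i)) = xg n i \<and> k (h (yg n i)) = yg n i"
    and "a \<in> carrier (FQT n)"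
  shows "k (h a) = a"
  using FQT_hom_unique[OF quandle_FQT qhom_compose[OF assms(1,2)] _ _ assms(4), of "\<lambda>a. a"] assms(3)
  by (simp add: qhom_def)


section \<open>The action of the virtual braid group\<close>

fun vb_x :: "nat \<Rightarrow> vb_gen \<Rightarrow> nat \<Rightarrow> (nat qterm set + nat) qterm set" where
  "vb_x n (Sigma i) k =
     (if k = i then xg n (i + 1) \<star>\<^bsub>FQT n\<^esub> xg n i else if k = i + 1 then xg n i else xg n k)"
| "vb_x n (Rho i) k =
     (if k = i then xg n (i + 1) \<star>inv\<^bsub>FQT n\<^esub> yg n i
      else if k = i + 1 then xg n i \<star>\<^bsub>FQT n\<^esub> yg n (i + 1) else xg n k)"

definition swap_next :: "nat \<Rightarrow> nat \<Rightarrow> nat" where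
  "swap_next i k = (if k = i then i + 1 else if k = i + 1 then i else k)"

fun vb_perm :: "vb_gen \<Rightarrow> nat \<Rightarrow> nat" where
  "vb_perm (Sigma i) = swap_next i"
| "vb_perm (Rho i) = swap_next i"

lemma vb_gens_iff [simp]:
  "Sigma i \<in> vb_gens n \<longleftrightarrow> 1 \<le> i \<and> i < n"
  "Rho i \<in> vb_gens n \<longleftrightarrow> 1 \<le> i \<and> i < n"
  by (auto simp: vb_gens_def)

lemma swap_next_closed: "1 \<le> i \<Longrightarrow> i < n \<Longrightarrow> k \<in> {1..n} \<Longrightarrow> swap_next i k \<in> {1..n}"
  by (auto simp: swap_next_def)

lemma vb_perm_closed: "g \<in> vb_gens n \<Longrightarrow> k \<in> {1..n} \<Longrightarrow> vb_perm g k \<in> {1..n}"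
  by (cases g) (simp_all only: vb_perm.simps vb_gens_iff swap_next_closed)

lemma vb_x_closed: "g \<in> vb_gens n \<Longrightarrow> k \<in> {1..n} \<Longrightarrow> vb_x n g k \<in> carrier (FQT n)"
  by (cases g) (auto simp: xg_closed yg_closed quandle_closed qinv_closed quandle_FQT)

text \<open>For \<open>g\<close> in \<open>vb_gens n\<close>, extensionality and the values on
  generators determine the map, so \<open>SOME\<close> involves no real choice; existence is the
  next lemma.\<close>

definition vb_act :: "nat \<Rightarrow> vb_gen \<Rightarrow>
    (nat qterm set + nat) qterm set \<Rightarrow> (nat qterm set + nat) qterm set" where
  "vb_act n g = (SOME h. h \<in> qhom (FQT n) (FQT n) \<and> h \<in> extensional (carrier (FQT n)) \<and>
     (\<forall>k\<in>{1..n}. h (xg n k) = vb_x n g k \<and> h (yg n k) = yg n (vb_perm g k)))"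

lemma vb_act:
  assumes "g \<in> vb_gens n"
  shows "vb_act n g \<in> qhom (FQT n) (FQT n) \<and> vb_act n g \<in> extensional (carrier (FQT n)) \<and>
     (\<forall>k\<in>{1..n}. vb_act n g (xg n k) = vb_x n g k \<and> vb_act n g (yg n k) = yg n (vb_perm g k))"
  unfolding vb_act_def
proof (rule someI_ex[OF FQT_extend])
  show "vb_x n g \<in> {1..n} \<rightarrow> carrier (FQT n)"
    using vb_x_closed[OF assms] by blast
  show "(\<lambda>k. yg n (vb_perm g k)) \<in> {1..n} \<rightarrow> carrier (FQT n)"
    using vb_perm_closed[OF assms] yg_closed by blast
  show "yg n (vb_perm g i) \<star>\<^bsub>FQT n\<^esub> yg n (vb_perm g j) = yg n (vb_perm g i)"
    if "i \<in> {1..n}" "j \<in> {1..n}" for i j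
    using that by (intro yg_op vb_perm_closed[OF assms])
qed (rule quandle_FQT)

lemmas vb_act_hom = vb_act[THEN conjunct1]

lemma vb_act_gens:
  assumes "g \<in> vb_gens n" "1 \<le> k" "k \<le> n"
  shows "vb_act n g (xg n k) = vb_x n g k" "vb_act n g (yg n k) = yg n (vb_perm g k)"
  using vb_act[OF assms(1)] assms(2,3) by simp_all

text \<open>For evaluating words on generators: the action is pushed inward to the \<open>xg\<close>
  and \<open>yg\<close>, and opposite translations cancel.\<close>

lemmas vb_act_simps = vb_act_gens qhom_op[OF vb_act_hom]
  qhom_qinv[OF quandle_FQT quandle_FQT vb_act_hom]
  quandle_FQT xg_closed yg_closed quandle_closed[OF quandle_FQT] qinv_closed[OF quandle_FQT]
  op_qinv[OF quandle_FQT] qinv_op[OF quandle_FQT] swap_next_def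

section \<open>Invertibility of the generators' actions\<close>

lemma vb_act_rho_rho:
  assumes "1 \<le> i" "i < n" "a \<in> carrier (FQT n)"
  shows "vb_act n (Rho i) (vb_act n (Rho i) a) = a"
proof (rule FQT_endo_eq_id[OF vb_act_hom vb_act_hom _ assms(3)])
  \<comment> \<open>The second application turns \<open>y_i\<close> into \<open>y_{i+1}\<close> and
    back, so the two translations collected by \<open>x_i\<close> or \<open>x_{i+1}\<close> are
    opposite ones by the same element.\<close>
  fix k assume "k \<in> {1..n}"
  then show "vb_act n (Rho i) (vb_act n (Rho i) (xg n k)) = xg n k \<and>
      vb_act n (Rho i) (vb_act n (Rho i) (yg n k)) = yg n k"
    using assms(1,2) by (simp add: vb_act_simps)
qed (use assms in simp_all)

lemma vb_act_sigma_inverse: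
  assumes "1 \<le> i" "i < n"
  obtains h where "h \<in> qhom (FQT n) (FQT n)"
    and "\<And>a. a \<in> carrier (FQT n) \<Longrightarrow> h (vb_act n (Sigma i) a) = a"
    and "\<And>a. a \<in> carrier (FQT n) \<Longrightarrow> vb_act n (Sigma i) (h a) = a"
proof -
  \<comment> \<open>The candidate inverse: one composite sends \<open>x_i\<close> to
    \<open>(x_i *^-1 x_{i+1}) * x_{i+1}\<close>, the other sends \<open>x_{i+1}\<close> to
    \<open>(x_{i+1} * x_i) *^-1 x_i\<close>, and both cancel.\<close>
  let ?f = "\<lambda>k. if k = i then xg n (i + 1)
    else if k = i + 1 then xg n i \<star>inv\<^bsub>FQT n\<^esub> xg n (i + 1) else xg n k"
  let ?g = "\<lambda>k. yg n (swap_next i k)"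
  have "\<exists>h. h \<in> qhom (FQT n) (FQT n) \<and> h \<in> extensional (carrier (FQT n)) \<and>
    (\<forall>k\<in>{1..n}. h (xg n k) = ?f k \<and> h (yg n k) = ?g k)"
  proof (rule FQT_extend)
    show "?f \<in> {1..n} \<rightarrow> carrier (FQT n)"
      using assms by (auto simp: xg_closed qinv_closed quandle_FQT)
    show "?g \<in> {1..n} \<rightarrow> carrier (FQT n)"
      using swap_next_closed[OF assms] yg_closed by blast
    show "?g j \<star>\<^bsub>FQT n\<^esub> ?g k = ?g j" if "j \<in> {1..n}" "k \<in> {1..n}" for j k
      using that by (intro yg_op swap_next_closed[OF assms])
  qed (rule quandle_FQT)
  then obtain h where h: "h \<in> qhom (FQT n) (FQT n)"
    and gens: "\<And>k. 1 \<le> k \<Longrightarrow> k \<le> n \<Longrightarrow> h (xg n k) = ?f k"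
      "\<And>k. 1 \<le> k \<Longrightarrow> k \<le> n \<Longrightarrow> h (yg n k) = ?g k"
    by (auto simp del: One_nat_def)
  note simps = gens qhom_op[OF h] qhom_qinv[OF quandle_FQT quandle_FQT h] vb_act_simps
  have s: "vb_act n (Sigma i) \<in> qhom (FQT n) (FQT n)"
    using assms by (simp add: vb_act_hom)
  show thesis
  proof
    show "h \<in> qhom (FQT n) (FQT n)" by fact
    show "h (vb_act n (Sigma i) a) = a" if "a \<in> carrier (FQT n)" for a
      by (rule FQT_endo_eq_id[OF s h _ that]) (use assms in \<open>simp add: simps\<close>)
    show "vb_act n (Sigma i) (h a) = a" if "a \<in> carrier (FQT n)" for a
      by (rule FQT_endo_eq_id[OF h s _ that]) (use assms in \<open>simp add: simps\<close>)
  qed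
qed

lemma vb_act_qaut:
  assumes "g \<in> vb_gens n"
  shows "vb_act n g \<in> carrier (qaut (FQT n))"
proof (cases g)
  case (Sigma i)
  then have "1 \<le> i" "i < n" using assms by simp_all
  then obtain h where "h \<in> qhom (FQT n) (FQT n)"
    and "\<And>a. a \<in> carrier (FQT n) \<Longrightarrow> h (vb_act n (Sigma i) a) = a"
    and "\<And>a. a \<in> carrier (FQT n) \<Longrightarrow> vb_act n (Sigma i) (h a) = a"
    using vb_act_sigma_inverse by blast
  then show ?thesis using Sigma vb_act[OF assms] by (intro qautI[of _ _ h]) simp_all
next
  case (Rho i)
  then show ?thesis
    using assms vb_act[OF assms] vb_act_rho_rho
    by (intro qautI[of _ _ "vb_act n (Rho i)"]) simp_all
qed

section \<open>Verification of the defining relations\<close>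

lemma fold_vb_act_hom:
  "set gs \<subseteq> vb_gens n \<Longrightarrow> h \<in> qhom (FQT n) (FQT n) \<Longrightarrow>
    (\<lambda>a. fold (vb_act n) gs (h a)) \<in> qhom (FQT n) (FQT n)"
  \<comment> \<open>The general \<open>h\<close> absorbs the letters already applied.\<close>
  by (induction gs arbitrary: h) (simp_all add: qhom_compose[OF _ vb_act_hom])

lemma vb_act_word_eqI:
  assumes "set us \<subseteq> vb_gens n" "set vs \<subseteq> vb_gens n"
    and "\<And>k. k \<in> {1..n} \<Longrightarrow> fold (vb_act n) us (xg n k) = fold (vb_act n) vs (xg n k) \<and>
      fold (vb_act n) us (yg n k) = fold (vb_act n) vs (yg n k)"
  shows "geval (qaut (FQT n)) (vb_act n) (vb_word us) = geval (qaut (FQT n)) (vb_act n) (vb_word vs)"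
proof -
  have act: "vb_act n \<in> vb_gens n \<rightarrow> carrier (qaut (FQT n))"
    using vb_act_qaut by blast
  have id: "(\<lambda>a. a) \<in> qhom (FQT n) (FQT n)" by (simp add: qhom_def)
  have "fold (vb_act n) us a = fold (vb_act n) vs a" if "a \<in> carrier (FQT n)" for a
    by (rule FQT_hom_unique[OF quandle_FQT fold_vb_act_hom[OF assms(1) id]
          fold_vb_act_hom[OF assms(2) id] assms(3) that])
  then show ?thesis
    unfolding qaut_eval_word[OF quandle_FQT act assms(1)] qaut_eval_word[OF quandle_FQT act assms(2)]
    by (rule restrict_ext)
qed

lemmas translate_commute = op_commute[OF quandle_FQT] op_qinv_commute[OF quandle_FQT]
  qinv_commute[OF quandle_FQT]

text \<open>Only \<open>x_i\<close> needs an argument: its images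
  \<open>(x_{i+2} * x_i) * (x_{i+1} * x_i)\<close> and \<open>(x_{i+2} * x_{i+1}) * x_i\<close>
  agree by self-distributivity.\<close>

lemma vb_act_sigma_braid:
  assumes "i \<in> {1..n - 2}"
  shows "geval (qaut (FQT n)) (vb_act n) (vb_word [Sigma i, Sigma (i+1), Sigma i]) =
    geval (qaut (FQT n)) (vb_act n) (vb_word [Sigma (i+1), Sigma i, Sigma (i+1)])"
  by (rule vb_act_word_eqI)
     (use assms in \<open>auto simp: vb_act_simps quandle_distrib[OF quandle_FQT, symmetric]\<close>)

text \<open>The images of \<open>x_i\<close>, \<open>x_{i+1}\<close>, \<open>x_{i+2}\<close> under
  the two sides differ only in the order of two translations by \<open>y\<close>'s: both inverse,
  one of each kind, and both direct, respectively.\<close>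

lemma vb_act_rho_braid:
  assumes "i \<in> {1..n - 2}"
  shows "geval (qaut (FQT n)) (vb_act n) (vb_word [Rho i, Rho (i+1), Rho i]) =
    geval (qaut (FQT n)) (vb_act n) (vb_word [Rho (i+1), Rho i, Rho (i+1)])"
  by (rule vb_act_word_eqI)
     (use assms in \<open>auto simp: vb_act_simps yg_op translate_commute\<close>)

text \<open>On \<open>x_i\<close> the right side gives
  \<open>(x_{i+2} * (x_i * y_{i+1})) *^-1 y_{i+1}\<close>, which distributes to
  \<open>(x_{i+2} *^-1 y_{i+1}) * x_i\<close>. On \<open>x_{i+1}\<close> the same law is used with
  \<open>y_{i+2} *^-1 y_i = y_{i+2}\<close>.\<close>

lemma vb_act_mixed:
  assumes "i \<in> {1..n - 2}"
  shows "geval (qaut (FQT n)) (vb_act n) (vb_word [Rho (i+1), Sigma i, Rho (i+1)]) =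
    geval (qaut (FQT n)) (vb_act n) (vb_word [Rho i, Sigma (i+1), Rho i])"
  by (rule vb_act_word_eqI)
     (use assms in \<open>auto simp: vb_act_simps yg_qinv qinv_distrib[OF quandle_FQT]\<close>)

lemma vb_act_rho_involution:
  assumes "i \<in> {1..n - 1}"
  shows "geval (qaut (FQT n)) (vb_act n) (vb_word [Rho i, Rho i]) = geval (qaut (FQT n)) (vb_act n) []"
proof -
  have "1 \<le> i" "i < n" using assms by auto
  then show ?thesis
    using vb_act_word_eqI[of "[Rho i, Rho i]" n "[]"]
    by (simp add: vb_act_rho_rho xg_closed yg_closed)
qed

lemma vb_act_far:
  assumes "far n i j"
  shows "geval (qaut (FQT n)) (vb_act n) (vb_word [Sigma i, Sigma j]) =
      geval (qaut (FQT n)) (vb_act n) (vb_word [Sigma j, Sigma i])"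
    and "geval (qaut (FQT n)) (vb_act n) (vb_word [Rho i, Rho j]) =
      geval (qaut (FQT n)) (vb_act n) (vb_word [Rho j, Rho i])"
    and "geval (qaut (FQT n)) (vb_act n) (vb_word [Sigma i, Rho j]) =
      geval (qaut (FQT n)) (vb_act n) (vb_word [Rho j, Sigma i])"
proof -
  \<comment> \<open>The pairs \<open>{i, i+1}\<close> and \<open>{j, j+1}\<close> are disjoint, so
    the two actions move different generators, to terms in their own pair.\<close>
  have ij: "1 \<le> i" "i < n" "1 \<le> j" "j < n" "i \<noteq> j" "i + 1 \<noteq> j" "i \<noteq> j + 1"
    using assms by (auto simp: far_def)
  show "geval (qaut (FQT n)) (vb_act n) (vb_word [Sigma i, Sigma j]) =
      geval (qaut (FQT n)) (vb_act n) (vb_word [Sigma j, Sigma i])"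
    by (rule vb_act_word_eqI) (use ij in \<open>auto simp: vb_act_simps\<close>)
  show "geval (qaut (FQT n)) (vb_act n) (vb_word [Rho i, Rho j]) =
      geval (qaut (FQT n)) (vb_act n) (vb_word [Rho j, Rho i])"
    by (rule vb_act_word_eqI) (use ij in \<open>auto simp: vb_act_simps\<close>)
  show "geval (qaut (FQT n)) (vb_act n) (vb_word [Sigma i, Rho j]) =
      geval (qaut (FQT n)) (vb_act n) (vb_word [Rho j, Sigma i])"
    by (rule vb_act_word_eqI) (use ij in \<open>auto simp: vb_act_simps\<close>)
qed

lemma vb_act_rels:
  assumes "(u, v) \<in> vb_rels n"
  shows "geval (qaut (FQT n)) (vb_act n) u = geval (qaut (FQT n)) (vb_act n) v"
  using assms unfolding vb_rels_def
  \<comment> \<open>The commutations of two \<open>Sigma\<close>'s or two \<open>Rho\<close>'s are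
    permutative equations, so they are applied as rules after the rewriting.\<close>
  by (elim UnE CollectE exE conjE Pair_inject)
     (simp_all only: vb_act_sigma_braid vb_act_rho_braid vb_act_mixed vb_act_far(3)
        vb_act_rho_involution, (rule vb_act_far, assumption)+)

theorem theorem3:
  fixes n :: nat
  assumes "n \<ge> 2"
  shows "\<exists>\<phi> \<in> hom (virtual_braid_group n) (qaut (FQT n)). \<forall>i \<in> {1..n - 1}.
    \<phi> (vb_sigma n i) (xg n i) = xg n (i + 1) \<star>\<^bsub>FQT n\<^esub> xg n i \<and>
    \<phi> (vb_sigma n i) (xg n (i + 1)) = xg n i \<and>
    \<phi> (vb_sigma n i) (yg n i) = yg n (i + 1) \<and>
    \<phi> (vb_sigma n i) (yg n (i + 1)) = yg n i \<and>
    (\<forall>k \<in> {1..n} - {i, i + 1}.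
       \<phi> (vb_sigma n i) (xg n k) = xg n k \<and> \<phi> (vb_sigma n i) (yg n k) = yg n k) \<and>
    \<phi> (vb_rho n i) (xg n i) = xg n (i + 1) \<star>inv\<^bsub>FQT n\<^esub> yg n i \<and>
    \<phi> (vb_rho n i) (xg n (i + 1)) = xg n i \<star>\<^bsub>FQT n\<^esub> yg n (i + 1) \<and>
    \<phi> (vb_rho n i) (yg n i) = yg n (i + 1) \<and>
    \<phi> (vb_rho n i) (yg n (i + 1)) = yg n i \<and>
    (\<forall>k \<in> {1..n} - {i, i + 1}.
       \<phi> (vb_rho n i) (xg n k) = xg n k \<and> \<phi> (vb_rho n i) (yg n k) = yg n k)"
proof -
  have "vb_act n \<in> vb_gens n \<rightarrow> carrier (qaut (FQT n))"
    using vb_act_qaut by blast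
  \<comment> \<open>All relations hold among the automorphisms \<open>vb_act n g\<close>, so the
    universal property of the presentation yields the homomorphism.\<close>
  from gpres_extend[OF group_qaut[OF quandle_FQT] this vb_act_rels]
  obtain \<phi> where \<phi>: "\<phi> \<in> hom (virtual_braid_group n) (qaut (FQT n))"
    and gens: "\<forall>g\<in>vb_gens n. \<phi> (gcls (vb_gens n) (vb_rels n) [(g, True)]) = vb_act n g"
    unfolding virtual_braid_group_def by blast
  have "\<phi> (vb_sigma n i) = vb_act n (Sigma i)" "\<phi> (vb_rho n i) = vb_act n (Rho i)"
    if "1 \<le> i" "i < n" for i
    using gens that by (simp_all add: vb_sigma_def vb_rho_def)
  then show ?thesis
    by (intro bexI[OF _ \<phi>]) (auto simp: vb_act_gens swap_next_def)
qed

end
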